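(* Let $(X_t)_{t\ge 0}$ be the real-valued process solving the stochastic differential equation $dX_t = a(X_t,t)\,dt+\sigma(X_t,t)\,dW_t$ with (random) initial value $X_0$, where $(W_t)_{t\ge0}$ is standard Brownian motion, $a(x,t)$ and $\sigma(x,t)>0$ are real-valued smooth functions, and let $b_t(x)=b(x,t)=\sigma(x,t)^2$. Assume the standing regularity assumptions listed in the context. Then for $t>0$ $$\frac{d}{dt} I(X_0;X_t) = -\frac12 J_{b_t}(X_0;X_t).$$
   Context: Entropy: $H(Y)=-\int_{\mathbb{R}}p_Y(y)\log p_Y(y)\,dy$; conditional entropy $H(Y\,|\,X)=\int_{\mathbb{R}} p_X(x)H(Y\,|\,X=x)\,dx$, where $H(Y\,|\,X=x)$ is the entropy of the conditional density $p_{Y|X}(\cdot\,|\,x)$; mutual information $I(X;Y)=H(Y)-H(Y\,|\,X)$. Generalized Fisher information with respect to a positive function $\beta:\mathbb{R}\to(0,\infty)$: $J_\beta(Y)=\int_{\mathbb{R}}\beta(y)\frac{p_Y'(y)^2}{p_Y(y)}\,dy$. Conditional Fisher information: $J_\beta(Y\,|\,X)=\int_{\mathbb{R}}p_X(x)J_\beta(Y\,|\,X=x)\,dx$, where $J_\beta(Y\,|\,X=x)$ is the Fisher information of the conditional density $p_{Y|X}(\cdot\,|\,x)$. Mutual Fisher information: $J_\beta(X;Y)=J_\beta(Y\,|\,X)-J_\beta(Y)$. Standing regularity assumptions: $a$ and $\sigma$ satisfy regularity and growth conditions (e.g. smooth and Lipschitz) under which, for $t>0$, the density $p(x,t)$ of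 $X_t$, as well as the conditional density of $X_t$ given $X_0=x_0$ for each $x_0$, exists and satisfies the Fokker-Planck equation $\frac{\partial p}{\partial t}=-\frac{\partial}{\partial x}(a p)+\frac12\frac{\partial^2}{\partial x^2}(b p)$. Densities are positive, smooth and rapidly decreasing, in the sense that all integrals involved converge, one may differentiate under the integral sign (including under the average over $X_0$), and every integration by parts (involving products of $a$, $b$, densities, their logarithms, and their derivatives) has zero boundary terms. *)

theory Defs
  imports "HOL-Probability.Probability"
begin

(* Functions of time and space take the time argument first: a t x, p t x. *)

section \<open>Smoothness and differential entropy\<close>

(* All partial derivatives of all orders exist and are continuous on T \<times> \<real>;
   the time derivative is one-sided at a boundary point of T. *)
coinductive smooth_on :: "real set \<Rightarrow> (real \<Rightarrow> real \<Rightarrow> real) \<Rightarrow> bool" for T where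
  "\<lbrakk>continuous_on (T \<times> UNIV) (\<lambda>(t, x). f t x);
    \<And>t x. t \<in> T \<Longrightarrow> ((\<lambda>s. f s x) has_real_derivative ft t x) (at t within T);
    \<And>t x. t \<in> T \<Longrightarrow> (f t has_real_derivative fx t x) (at x);
    smooth_on T ft; smooth_on T fx\<rbrakk> \<Longrightarrow> smooth_on T f"

definition dentropy :: "(real \<Rightarrow> real) \<Rightarrow> real" where
  "dentropy p = - (LINT y|lborel. p y * ln (p y))"

lemma (in prob_space) dentropy_eq_entropy:
  assumes "distributed M lborel Y (\<lambda>y. ennreal (p y))" and "\<And>y. 0 \<le> p y"
  shows "entropy (exp 1) lborel Y = dentropy p"
proof -
  interpret information_space M "exp 1"
    by unfold_locales simp
  show ?thesis
    using entropy_distr[OF assms] by (simp add: dentropy_def log_def)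
qed

definition cond_dentropy :: "(real \<Rightarrow> real) \<Rightarrow> (real \<Rightarrow> real \<Rightarrow> real) \<Rightarrow> real" where
  "cond_dentropy pX q = (LINT x|lborel. pX x * dentropy (q x))"

(* pX, pY: densities of X and Y; q x: conditional density of Y given X = x. *)
definition mutual_info ::
    "(real \<Rightarrow> real) \<Rightarrow> (real \<Rightarrow> real) \<Rightarrow> (real \<Rightarrow> real \<Rightarrow> real) \<Rightarrow> real" where
  "mutual_info pX pY q = dentropy pY - cond_dentropy pX q"


section \<open>Generalized Fisher information\<close>

definition fisher :: "(real \<Rightarrow> real) \<Rightarrow> (real \<Rightarrow> real) \<Rightarrow> real" where
  "fisher \<beta> p = (LINT y|lborel. \<beta> y * ((deriv p y)\<^sup>2 / p y))"

definition cond_fisher ::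
    "(real \<Rightarrow> real) \<Rightarrow> (real \<Rightarrow> real) \<Rightarrow> (real \<Rightarrow> real \<Rightarrow> real) \<Rightarrow> real" where
  "cond_fisher \<beta> pX q = (LINT x|lborel. pX x * fisher \<beta> (q x))"

definition mutual_fisher ::
    "(real \<Rightarrow> real) \<Rightarrow> (real \<Rightarrow> real) \<Rightarrow> (real \<Rightarrow> real) \<Rightarrow> (real \<Rightarrow> real \<Rightarrow> real) \<Rightarrow> real" where
  "mutual_fisher \<beta> pX pY q = cond_fisher \<beta> pX q - fisher \<beta> pY"

definition cond_density ::
    "'w measure \<Rightarrow> ('w \<Rightarrow> real) \<Rightarrow> ('w \<Rightarrow> real) \<Rightarrow> (real \<Rightarrow> real) \<Rightarrow> (real \<Rightarrow> real \<Rightarrow> real) \<Rightarrow> bool" where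
  "cond_density M X Y pX q \<longleftrightarrow>
     (\<lambda>(x, y). q x y) \<in> borel_measurable (lborel \<Otimes>\<^sub>M lborel) \<and>
     (\<forall>x. (\<forall>y. 0 \<le> q x y) \<and> (\<integral>\<^sup>+y. ennreal (q x y) \<partial>lborel) = 1) \<and>
     distributed M (lborel \<Otimes>\<^sub>M lborel) (\<lambda>\<omega>. (X \<omega>, Y \<omega>)) (\<lambda>(x, y). ennreal (pX x * q x y))"


section \<open>Stochastic differential equations\<close>

definition brownian_motion ::
    "'w measure \<Rightarrow> (real \<Rightarrow> 'w measure) \<Rightarrow> (real \<Rightarrow> 'w \<Rightarrow> real) \<Rightarrow> bool" where
  "brownian_motion M F W \<longleftrightarrow>
     filtration (space M) F \<and> (\<forall>t. subalgebra M (F t)) \<and>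
     (\<forall>t\<ge>0. W t \<in> borel_measurable (F t)) \<and>
     (AE \<omega> in M. W 0 \<omega> = 0) \<and>
     (AE \<omega> in M. continuous_on {0..} (\<lambda>t. W t \<omega>)) \<and>
     (\<forall>s t. 0 \<le> s \<and> s < t \<longrightarrow>
        distributed M lborel (\<lambda>\<omega>. W t \<omega> - W s \<omega>)
          (\<lambda>x. ennreal (normal_density 0 (sqrt (t - s)) x)) \<and>
        prob_space.indep_set M (sets (F s))
          {(\<lambda>\<omega>. W t \<omega> - W s \<omega>) -` A \<inter> space M | A. A \<in> sets borel})"

definition progressively_measurable ::
    "'w measure \<Rightarrow> (real \<Rightarrow> 'w measure) \<Rightarrow> (real \<Rightarrow> 'w \<Rightarrow> real) \<Rightarrow> bool" where
  "progressively_measurable M F H \<longleftrightarrow>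
     (\<forall>t\<ge>0. (\<lambda>(s, \<omega>). H s \<omega>) \<in> borel_measurable (restrict_space borel {0..t} \<Otimes>\<^sub>M F t))"

(* (n, \<tau>, \<xi>) represents the integrand that equals \<xi> i on the interval (\<tau> i, \<tau> (i+1)], i < n. *)
type_synonym 'w simple_integrand = "nat \<times> (nat \<Rightarrow> real) \<times> (nat \<Rightarrow> 'w \<Rightarrow> real)"

definition simple_integrand ::
    "'w measure \<Rightarrow> (real \<Rightarrow> 'w measure) \<Rightarrow> real \<Rightarrow> 'w simple_integrand \<Rightarrow> bool" where
  "simple_integrand M F T = (\<lambda>(n, \<tau>, \<xi>).
     \<tau> 0 = 0 \<and> \<tau> n = T \<and>
     (\<forall>i<n. \<tau> i < \<tau> (Suc i) \<and> \<xi> i \<in> borel_measurable (F (\<tau> i)) \<and>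
            (\<exists>C. \<forall>\<omega>\<in>space M. \<bar>\<xi> i \<omega>\<bar> \<le> C)))"

definition simple_process :: "'w simple_integrand \<Rightarrow> real \<Rightarrow> 'w \<Rightarrow> real" where
  "simple_process = (\<lambda>(n, \<tau>, \<xi>) s \<omega>. \<Sum>i<n. \<xi> i \<omega> * indicator {\<tau> i<..\<tau> (Suc i)} s)"

definition simple_integral :: "(real \<Rightarrow> 'w \<Rightarrow> real) \<Rightarrow> 'w simple_integrand \<Rightarrow> 'w \<Rightarrow> real" where
  "simple_integral W = (\<lambda>(n, \<tau>, \<xi>) \<omega>. \<Sum>i<n. \<xi> i \<omega> * (W (\<tau> (Suc i)) \<omega> - W (\<tau> i) \<omega>))"

definition tends_to_zero_in_prob :: "'w measure \<Rightarrow> (nat \<Rightarrow> 'w \<Rightarrow> ennreal) \<Rightarrow> bool" where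
  "tends_to_zero_in_prob M Y \<longleftrightarrow>
     (\<forall>\<epsilon>>0. (\<lambda>k. measure M {\<omega> \<in> space M. Y k \<omega> > ennreal \<epsilon>}) \<longlonglongrightarrow> 0)"

(* I is (a version of) the Ito integral of H with respect to W over [0, T]: the limit in
   probability of integrals of simple integrands that approximate H in L2[0, T] in probability. *)
definition has_ito_integral ::
    "'w measure \<Rightarrow> (real \<Rightarrow> 'w measure) \<Rightarrow> (real \<Rightarrow> 'w \<Rightarrow> real) \<Rightarrow> real \<Rightarrow>
     (real \<Rightarrow> 'w \<Rightarrow> real) \<Rightarrow> ('w \<Rightarrow> real) \<Rightarrow> bool" where
  "has_ito_integral M F W T H I \<longleftrightarrow>
     progressively_measurable M F H \<and> I \<in> borel_measurable M \<and>
     (\<exists>S. (\<forall>k. simple_integrand M F T (S k)) \<and>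
        tends_to_zero_in_prob M
          (\<lambda>k \<omega>. \<integral>\<^sup>+s\<in>{0..T}. ennreal ((H s \<omega> - simple_process (S k) s \<omega>)\<^sup>2) \<partial>lborel) \<and>
        tends_to_zero_in_prob M (\<lambda>k \<omega>. ennreal \<bar>simple_integral W (S k) \<omega> - I \<omega>\<bar>))"

(* dX = a(X, t) dt + \<sigma>(X, t) dW in integrated form; the integrals start at time 0. *)
definition solves_sde ::
    "'w measure \<Rightarrow> (real \<Rightarrow> 'w measure) \<Rightarrow> (real \<Rightarrow> 'w \<Rightarrow> real) \<Rightarrow>
     (real \<Rightarrow> real \<Rightarrow> real) \<Rightarrow> (real \<Rightarrow> real \<Rightarrow> real) \<Rightarrow> (real \<Rightarrow> 'w \<Rightarrow> real) \<Rightarrow> bool" where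
  "solves_sde M F W a \<sigma> X \<longleftrightarrow>
     (\<forall>t\<ge>0. X t \<in> borel_measurable (F t)) \<and>
     (AE \<omega> in M. continuous_on {0..} (\<lambda>t. X t \<omega>)) \<and>
     (\<forall>t\<ge>0. \<exists>I. has_ito_integral M F W t (\<lambda>s \<omega>. \<sigma> s (X s \<omega>)) I \<and>
        (AE \<omega> in M. X t \<omega> = X 0 \<omega> + (LINT s:{0..t}|lborel. a s (X s \<omega>)) + I \<omega>))"


section \<open>Regularity assumptions on densities\<close>

definition fokker_planck ::
    "(real \<Rightarrow> real \<Rightarrow> real) \<Rightarrow> (real \<Rightarrow> real \<Rightarrow> real) \<Rightarrow> (real \<Rightarrow> real \<Rightarrow> real) \<Rightarrow> bool" where
  "fokker_planck a b p \<longleftrightarrow>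
     (\<forall>t>0. \<forall>x. ((\<lambda>s. p s x) has_real_derivative
        - deriv (\<lambda>y. a t y * p t y) x + 1/2 * (deriv ^^ 2) (\<lambda>y. b t y * p t y) x) (at t))"

definition diff_under_integral :: "(real \<Rightarrow> real \<Rightarrow> real) \<Rightarrow> real \<Rightarrow> bool" where
  "diff_under_integral f t \<longleftrightarrow>
     integrable lborel (\<lambda>x. deriv (\<lambda>s. f s x) t) \<and>
     ((\<lambda>s. LINT x|lborel. f s x) has_real_derivative (LINT x|lborel. deriv (\<lambda>s. f s x) t)) (at t)"

(* Integration by parts of f' g over \<real> has convergent integrals and no boundary terms. *)
definition by_parts :: "(real \<Rightarrow> real) \<Rightarrow> (real \<Rightarrow> real) \<Rightarrow> bool" where
  "by_parts f g \<longleftrightarrow>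
     integrable lborel (\<lambda>x. deriv f x * g x) \<and> integrable lborel (\<lambda>x. f x * deriv g x) \<and>
     ((\<lambda>x. f x * g x) \<longlongrightarrow> 0) at_top \<and> ((\<lambda>x. f x * g x) \<longlongrightarrow> 0) at_bot"

(* The by_parts conditions are those met when the time derivatives of the integrals of p and of
   p ln p are computed from the Fokker-Planck equation; the factor 1 covers integrals of
   total derivatives. *)
definition regular_density ::
    "(real \<Rightarrow> real \<Rightarrow> real) \<Rightarrow> (real \<Rightarrow> real \<Rightarrow> real) \<Rightarrow> (real \<Rightarrow> real \<Rightarrow> real) \<Rightarrow> bool" where
  "regular_density a b p \<longleftrightarrow>
     smooth_on {0<..} p \<and>
     (\<forall>t>0.
        (\<forall>x. 0 < p t x) \<and>
        integrable lborel (\<lambda>x. p t x * ln (p t x)) \<and>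
        integrable lborel (\<lambda>x. b t x * ((deriv (p t) x)\<^sup>2 / p t x)) \<and>
        diff_under_integral (\<lambda>s x. p s x * ln (p s x)) t \<and>
        by_parts (\<lambda>x. a t x * p t x) (\<lambda>_. 1) \<and>
        by_parts (deriv (\<lambda>x. b t x * p t x)) (\<lambda>_. 1) \<and>
        by_parts (\<lambda>x. a t x * p t x) (\<lambda>x. ln (p t x)) \<and>
        by_parts (deriv (\<lambda>x. b t x * p t x)) (\<lambda>x. ln (p t x)) \<and>
        by_parts (a t) (p t) \<and>
        by_parts (deriv (b t)) (p t))"

(* Convergence of the averages over X_0, and differentiation of the conditional entropy under
   the average; q t x0 is the conditional density of X_t given X_0 = x0. *)
definition regular_average ::
    "(real \<Rightarrow> real \<Rightarrow> real) \<Rightarrow> (real \<Rightarrow> real) \<Rightarrow> (real \<Rightarrow> real \<Rightarrow> real \<Rightarrow> real) \<Rightarrow> bool" where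
  "regular_average b p0 q \<longleftrightarrow>
     (\<forall>t>0.
        integrable lborel (\<lambda>x0. p0 x0 * dentropy (q t x0)) \<and>
        integrable lborel (\<lambda>x0. p0 x0 * fisher (b t) (q t x0)) \<and>
        diff_under_integral (\<lambda>s x0. p0 x0 * dentropy (q s x0)) t)"

end

theory Submission
  imports Defs
begin

(* Inserting the Fokker-Planck equation into the time derivative of the entropy and integrating
   by parts gives
     d/dt H(p_t) = \<integral> (a' - b''/2) p_t + 1/2 J_b(p_t).
   The first term is linear in the density, hence the same for the density of X_t and, on average
   over X_0, for its conditional densities: it cancels in the mutual information. *)

text \<open>The product rule and the fundamental theorem of calculus over the whole line;
  \<open>by_parts\<close> supplies convergence of both integrals and vanishing boundary values. The
  derivatives are parameters rather than \<open>deriv\<close> terms so that closed forms can be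
  plugged in, and their continuity is what the fundamental theorem asks for.\<close>

lemma integral_by_parts:
  assumes f: "\<And>x. (f has_real_derivative f' x) (at x)" and f': "\<And>x. isCont f' x"
    and g: "\<And>x. (g has_real_derivative g' x) (at x)" and g': "\<And>x. isCont g' x"
    and bp: "by_parts f g"
  shows "(LINT x|lborel. f' x * g x) = - (LINT x|lborel. f x * g' x)"
proof -
  have "deriv f = f'" "deriv g = g'"
    using f g by (auto intro!: DERIV_imp_deriv)
  then have int: "integrable lborel (\<lambda>x. f' x * g x)" "integrable lborel (\<lambda>x. f x * g' x)"
    and lim: "((\<lambda>x. f x * g x) \<longlongrightarrow> 0) at_top" "((\<lambda>x. f x * g x) \<longlongrightarrow> 0) at_bot"
    using bp by (auto simp: by_parts_def)
  \<comment> \<open>The two zeros are the limits of the product at the upper and the lower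
    end.\<close>
  have "(LBINT x=-\<infinity>..\<infinity>. f' x * g x + f x * g' x) = 0 - 0"
  proof (rule interval_integral_FTC_integrable[where F = "\<lambda>x. f x * g x"])
    show "((\<lambda>x. f x * g x) has_vector_derivative f' x * g x + f x * g' x) (at x)" for x
      unfolding has_real_derivative_iff_has_vector_derivative[symmetric]
      by (rule derivative_eq_intros f g refl)+ simp
    show "isCont (\<lambda>x. f' x * g x + f x * g' x) x" for x
      by (intro continuous_intros f' g' DERIV_isCont[OF f] DERIV_isCont[OF g])
    show "set_integrable lborel (einterval (-\<infinity>) \<infinity>) (\<lambda>x. f' x * g x + f x * g' x)"
      using int by (simp add: set_integrable_def)
  qed (use lim in \<open>simp_all add: ereal_tendsto_simps1\<close>)
  then have "(LINT x|lborel. f' x * g x + f x * g' x) = 0"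
    by (simp add: interval_lebesgue_integral_def set_lebesgue_integral_def)
  then show ?thesis
    using int by simp
qed

lemma smooth_onE:
  assumes "smooth_on T f"
  obtains f' where "\<And>t x. t \<in> T \<Longrightarrow> (f t has_real_derivative f' t x) (at x)" "smooth_on T f'"
  using assms by (cases rule: smooth_on.cases) blast

text \<open>Each spatial derivative costs one unfolding of the coinductive predicate. The third
  unfolding serves only continuity: the second derivative is continuous because it is
  differentiable.\<close>

lemma smooth_on_derivatives:
  assumes "smooth_on T f" "t \<in> T"
  shows "(f t has_real_derivative deriv (f t) x) (at x)"
    and "(deriv (f t) has_real_derivative deriv (deriv (f t)) x) (at x)"
    and "isCont (deriv (deriv (f t))) x"
proof -
  obtain f1 where f1: "\<And>t x. t \<in> T \<Longrightarrow> (f t has_real_derivative f1 t x) (at x)"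
    and "smooth_on T f1" using smooth_onE[OF assms(1)] by metis
  obtain f2 where f2: "\<And>t x. t \<in> T \<Longrightarrow> (f1 t has_real_derivative f2 t x) (at x)"
    and "smooth_on T f2" using smooth_onE[OF \<open>smooth_on T f1\<close>] by metis
  obtain f3 where f3: "\<And>t x. t \<in> T \<Longrightarrow> (f2 t has_real_derivative f3 t x) (at x)"
    using smooth_onE[OF \<open>smooth_on T f2\<close>] by metis
  have 1: "deriv (f t) = f1 t"
    using f1[OF \<open>t \<in> T\<close>] by (auto intro: DERIV_imp_deriv)
  have 2: "deriv (f1 t) = f2 t"
    using f2[OF \<open>t \<in> T\<close>] by (auto intro: DERIV_imp_deriv)
  show "(f t has_real_derivative deriv (f t) x) (at x)"
    and "(deriv (f t) has_real_derivative deriv (deriv (f t)) x) (at x)"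
    and "isCont (deriv (deriv (f t))) x"
    unfolding 1 2 using f1 f2 DERIV_isCont[OF f3] \<open>t \<in> T\<close> by auto
qed

text \<open>Applied below both to the density of X_t and to each conditional density. The
  coefficients are therefore collected in one factor a' - b''/2 that does not involve the density,
  and integrability of its product with the density is recorded for the later averaging over
  X_0.\<close>

lemma dentropy_has_derivative:
  fixes a b p :: "real \<Rightarrow> real \<Rightarrow> real"
  assumes fp: "fokker_planck a b p" and reg: "regular_density a b p" and t: "0 < t"
    and a: "\<And>x. (a t has_real_derivative a' x) (at x)" "\<And>x. isCont a' x"
    and b: "\<And>x. (b t has_real_derivative b' x) (at x)"
           "\<And>x. (b' has_real_derivative b'' x) (at x)" "\<And>x. isCont b'' x"
  shows "((\<lambda>s. dentropy (p s)) has_real_derivative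
           (LINT x|lborel. (a' x - b'' x / 2) * p t x) + 1/2 * fisher (b t) (p t)) (at t)"
    and "integrable lborel (\<lambda>x. (a' x - b'' x / 2) * p t x)"
proof -
  define u where "u = p t"
  define u' where "u' = deriv u"
  define u'' where "u'' = deriv u'"
  have "smooth_on {0<..} p" using reg by (simp add: regular_density_def)
  from smooth_on_derivatives[OF this, of t] t
  have u: "(u has_real_derivative u' x) (at x)" "(u' has_real_derivative u'' x) (at x)"
    "isCont u'' x" for x by (simp_all add: u_def u'_def u''_def)
  have pos: "0 < u x" for x using reg t by (simp add: regular_density_def u_def)
  note cont = DERIV_isCont[OF a(1)] a(2) DERIV_isCont[OF b(1)] DERIV_isCont[OF b(2)] b(3)
    DERIV_isCont[OF u(1)] DERIV_isCont[OF u(2)] u(3)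

  \<comment> \<open>\<open>v\<close> is the drift flux a u, while \<open>w'\<close> and
    \<open>w''\<close> are the first two derivatives of b u. In these terms the Fokker-Planck
    equation says that the time derivative of p at t is - v' + w''/2.\<close>
  define v where "v x = a t x * u x" for x
  define v' where "v' x = a' x * u x + a t x * u' x" for x
  define w' where "w' x = b' x * u x + b t x * u' x" for x
  define w'' where "w'' x = b'' x * u x + 2 * b' x * u' x + b t x * u'' x" for x
  have v: "(v has_real_derivative v' x) (at x)" for x
    unfolding v_def v'_def by (rule derivative_eq_intros a u refl)+ simp
  have w: "((\<lambda>x. b t x * u x) has_real_derivative w' x) (at x)" for x
    unfolding w'_def by (rule derivative_eq_intros b u refl)+ simp
  have w': "(w' has_real_derivative w'' x) (at x)" for x
    unfolding w'_def w''_def by (rule derivative_eq_intros b u refl)+ (simp add: algebra_simps)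
  have cv': "isCont v' x" and cw'': "isCont w'' x" for x
    unfolding v'_def w''_def by (intro continuous_intros cont)+
  have lnu: "((\<lambda>x. ln (u x)) has_real_derivative u' x / u x) (at x)" for x
    using pos by (auto intro!: derivative_eq_intros u simp: field_simps)
  have clnu: "isCont (\<lambda>x. u' x / u x) x" for x
    using pos[of x] by (intro continuous_intros cont) simp
  have dv: "deriv v = v'" and dw: "deriv (\<lambda>x. b t x * u x) = w'" and dw': "deriv w' = w''"
    and da: "deriv (a t) = a'" and db: "deriv (b t) = b'" and db': "deriv b' = b''"
    and dlnu: "deriv (\<lambda>x. ln (u x)) = (\<lambda>x. u' x / u x)"
    using v w w' a b lnu by (auto intro!: DERIV_imp_deriv)

  have bp: "by_parts v (\<lambda>_. 1)" "by_parts w' (\<lambda>_. 1)"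
    "by_parts v (\<lambda>x. ln (u x))" "by_parts w' (\<lambda>x. ln (u x))"
    "by_parts (a t) u" "by_parts b' u"
    and intF: "integrable lborel (\<lambda>x. b t x * ((u' x)\<^sup>2 / u x))"
    and dui: "diff_under_integral (\<lambda>s x. p s x * ln (p s x)) t"
    using reg[unfolded regular_density_def, THEN conjunct2, rule_format, OF t,
        folded u_def, folded v_def[abs_def] u'_def, unfolded dw db]
    by blast+
  have int: "integrable lborel v'" "integrable lborel w''"
    "integrable lborel (\<lambda>x. v' x * ln (u x))" "integrable lborel (\<lambda>x. w'' x * ln (u x))"
    "integrable lborel (\<lambda>x. a' x * u x)" "integrable lborel (\<lambda>x. b'' x * u x)"
    "integrable lborel (\<lambda>x. b' x * u' x)"
    using bp by (simp_all add: by_parts_def dv dw' da db' u'_def)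

  \<comment> \<open>With second factor 1, integration by parts shows that both parts of the time
    derivative have integral zero: mass is conserved. This disposes of the 1 in (p ln p)' = ln p +
    1.\<close>
  have "(LINT x|lborel. v' x * 1) = - (LINT x|lborel. v x * 0)"
    by (intro integral_by_parts v cv' bp) auto
  then have i1: "(LINT x|lborel. v' x) = 0" by simp
  have "(LINT x|lborel. w'' x * 1) = - (LINT x|lborel. w' x * 0)"
    by (intro integral_by_parts w' cw'' bp) auto
  then have i2: "(LINT x|lborel. w'' x) = 0" by simp
  \<comment> \<open>Once the derivative falls on ln u, the density cancels and a u' remains; a
    second integration by parts moves the derivative from u to a.\<close>
  have "(LINT x|lborel. v' x * ln (u x)) = - (LINT x|lborel. v x * (u' x / u x))"
    by (intro integral_by_parts v cv' bp lnu clnu)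
  also have "(\<lambda>x. v x * (u' x / u x)) = (\<lambda>x. a t x * u' x)"
    using pos by (auto simp: v_def fun_eq_iff less_le)
  also have "- (LINT x|lborel. a t x * u' x) = (LINT x|lborel. a' x * u x)"
    by (subst integral_by_parts[of "a t" a' u u']) (auto intro: a u cont bp)
  finally have i3: "(LINT x|lborel. v' x * ln (u x)) = (LINT x|lborel. a' x * u x)" .
  \<comment> \<open>The product rule splits w' u'/u into b' u' and the Fisher integrand b u'^2/u.
    Only the first part is integrated by parts again.\<close>
  have "(LINT x|lborel. w'' x * ln (u x)) = - (LINT x|lborel. w' x * (u' x / u x))"
    by (intro integral_by_parts w' cw'' bp lnu clnu)
  also have "(\<lambda>x. w' x * (u' x / u x)) = (\<lambda>x. b' x * u' x + b t x * ((u' x)\<^sup>2 / u x))"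
    using pos by (auto simp: w'_def fun_eq_iff less_le field_simps power2_eq_square)
  also have "(LINT x|lborel. b' x * u' x + b t x * ((u' x)\<^sup>2 / u x)) =
      (LINT x|lborel. b' x * u' x) + fisher (b t) u"
    using int intF by (simp add: fisher_def u'_def)
  also have "(LINT x|lborel. b' x * u' x) = - (LINT x|lborel. b'' x * u x)"
    by (subst integral_by_parts[of b' b'' u u']) (auto intro: b u cont bp)
  finally have i4: "(LINT x|lborel. w'' x * ln (u x)) =
      (LINT x|lborel. b'' x * u x) - fisher (b t) u" by simp

  have dt: "((\<lambda>s. p s x) has_real_derivative - v' x + 1/2 * w'' x) (at t)" for x
    using fp[unfolded fokker_planck_def numeral_2_eq_2 funpow.simps comp_def id_apply, rule_format,
        OF t, folded u_def, folded v_def[abs_def], unfolded dv dw dw']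
    by simp
  \<comment> \<open>\<open>diff_under_integral\<close> speaks of \<open>deriv\<close>, so the
    pointwise time derivative has to be identified before it can be used under the integral.\<close>
  have "deriv (\<lambda>s. p s x * ln (p s x)) t = (- v' x + 1/2 * w'' x) * (ln (u x) + 1)" for x
  proof (rule DERIV_imp_deriv)
    show "((\<lambda>s. p s x * ln (p s x)) has_real_derivative
        (- v' x + 1/2 * w'' x) * (ln (u x) + 1)) (at t)"
      using pos[of x] unfolding u_def
      by (auto intro!: derivative_eq_intros dt simp: field_simps)
  qed
  then have "((\<lambda>s. LINT x|lborel. p s x * ln (p s x)) has_real_derivative
      (LINT x|lborel. (- v' x + 1/2 * w'' x) * (ln (u x) + 1))) (at t)"
    using dui by (simp add: diff_under_integral_def)
  moreover have "(LINT x|lborel. (- v' x + 1/2 * w'' x) * (ln (u x) + 1)) =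
      (LINT x|lborel. - (v' x * ln (u x)) - v' x + (1/2) * (w'' x * ln (u x)) + (1/2) * w'' x)"
    by (intro Bochner_Integration.integral_cong) (auto simp: algebra_simps)
  moreover have "\<dots> = - (LINT x|lborel. a' x * u x)
      + 1/2 * ((LINT x|lborel. b'' x * u x) - fisher (b t) u)"
    using int by (simp add: i1 i2 i3 i4)
  ultimately have "((\<lambda>s. LINT x|lborel. p s x * ln (p s x)) has_real_derivative
      - (LINT x|lborel. a' x * u x) + 1/2 * ((LINT x|lborel. b'' x * u x) - fisher (b t) u)) (at t)"
    by simp
  from DERIV_minus[OF this] have D: "((\<lambda>s. - (LINT x|lborel. p s x * ln (p s x))) has_real_derivative
      - (- (LINT x|lborel. a' x * u x) + 1/2 * ((LINT x|lborel. b'' x * u x) - fisher (b t) u)))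
      (at t)" .
  have split: "(\<lambda>x. (a' x - b'' x / 2) * p t x) = (\<lambda>x. a' x * u x - (1/2) * (b'' x * u x))"
    by (auto simp: u_def algebra_simps)
  show "integrable lborel (\<lambda>x. (a' x - b'' x / 2) * p t x)"
    unfolding split using int by simp
  have "(LINT x|lborel. (a' x - b'' x / 2) * p t x) =
      (LINT x|lborel. a' x * u x) - 1/2 * (LINT x|lborel. b'' x * u x)"
    unfolding split using int by simp
  then show "((\<lambda>s. dentropy (p s)) has_real_derivative
           (LINT x|lborel. (a' x - b'' x / 2) * p t x) + 1/2 * fisher (b t) (p t)) (at t)"
    unfolding dentropy_def by (intro DERIV_cong[OF D]) (simp add: u_def diff_divide_distrib)
qed

text \<open>The tower property: both sides are the expectation of g(Y), computed once from the joint
  density by Fubini and once from the marginal density. Integrability is transferred as well, so g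
  may be unbounded.\<close>

lemma cond_density_integral:
  fixes g :: "real \<Rightarrow> real"
  assumes X0: "\<And>x. 0 \<le> pX x" "distributed M lborel X (\<lambda>x. ennreal (pX x))"
    and Y: "\<And>y. 0 \<le> pY y" "distributed M lborel Y (\<lambda>y. ennreal (pY y))"
    and q: "cond_density M X Y pX q"
    and g[measurable]: "g \<in> borel_measurable borel" and int: "integrable lborel (\<lambda>y. g y * pY y)"
  shows "integrable lborel (\<lambda>x. pX x * (LINT y|lborel. g y * q x y))"
    and "(LINT x|lborel. pX x * (LINT y|lborel. g y * q x y)) = (LINT y|lborel. g y * pY y)"
proof -
  have q0: "0 \<le> q x y" for x y using q by (auto simp: cond_density_def)
  have d: "distributed M (lborel \<Otimes>\<^sub>M lborel) (\<lambda>\<omega>. (X \<omega>, Y \<omega>))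
      (\<lambda>z. ennreal (case z of (x, y) \<Rightarrow> pX x * q x y))"
    using q by (simp add: cond_density_def split_def)
  have nn: "0 \<le> (case z of (x, y) \<Rightarrow> pX x * q x y)" for z
    using X0(1) q0 by (auto split: prod.split)
  have gm: "(\<lambda>z. g (snd z)) \<in> borel_measurable (lborel \<Otimes>\<^sub>M lborel)" by measurable
  \<comment> \<open>The probability space links the two densities: integrability passes from the
    marginal to \<open>M\<close>, and from there to the product space, where Fubini needs
    it.\<close>
  have "integrable M (\<lambda>\<omega>. g (Y \<omega>))"
    using distributed_integrable[OF Y(2), of g] Y(1) int by (simp add: mult.commute)
  then have J: "integrable (lborel \<Otimes>\<^sub>M lborel) (\<lambda>(x, y). pX x * (g y * q x y))"
    using distributed_integrable[OF d gm] nn by (simp add: split_def mult_ac)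
  have "(LINT z|(lborel \<Otimes>\<^sub>M lborel). (case z of (x, y) \<Rightarrow> pX x * q x y) * g (snd z))
      = (LINT \<omega>|M. g (Y \<omega>))"
    using distributed_integral[OF d gm] nn by simp
  also have "\<dots> = (LINT y|lborel. g y * pY y)"
    using distributed_integral[OF Y(2), of g] Y(1) by (simp add: mult.commute)
  finally have E: "(LINT z|(lborel \<Otimes>\<^sub>M lborel). (case z of (x, y) \<Rightarrow> pX x * (g y * q x y)))
      = (LINT y|lborel. g y * pY y)" by (simp add: split_def mult_ac)
  show "integrable lborel (\<lambda>x. pX x * (LINT y|lborel. g y * q x y))"
    using lborel_pair.integrable_fst'[OF J] by simp
  show "(LINT x|lborel. pX x * (LINT y|lborel. g y * q x y)) = (LINT y|lborel. g y * pY y)"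
    using lborel_pair.integral_fst'[OF J] E by simp
qed

theorem theorem7:
  fixes M :: "'w measure" and F :: "real \<Rightarrow> 'w measure"
    and W X :: "real \<Rightarrow> 'w \<Rightarrow> real"
    and a \<sigma> b p :: "real \<Rightarrow> real \<Rightarrow> real"
    and p0 :: "real \<Rightarrow> real" and q :: "real \<Rightarrow> real \<Rightarrow> real \<Rightarrow> real" and t :: real
  assumes "prob_space M"
    and "brownian_motion M F W"
    and "smooth_on {0..} a" and "smooth_on {0..} \<sigma>"
    and "\<And>s x. 0 \<le> s \<Longrightarrow> 0 < \<sigma> s x"
    and "\<And>s x. b s x = (\<sigma> s x)\<^sup>2"
    and "solves_sde M F W a \<sigma> X"
    and "\<And>x. 0 \<le> p0 x"
    and "distributed M lborel (X 0) (\<lambda>x. ennreal (p0 x))"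
    and "\<And>s. 0 < s \<Longrightarrow> distributed M lborel (X s) (\<lambda>x. ennreal (p s x))"
    and "\<And>s. 0 < s \<Longrightarrow> cond_density M (X 0) (X s) p0 (q s)"
    and "fokker_planck a b p"
    and "\<And>x0. fokker_planck a b (\<lambda>s. q s x0)"
    and "regular_density a b p"
    and "\<And>x0. regular_density a b (\<lambda>s. q s x0)"
    and "regular_average b p0 q"
    and "0 < t"
  shows "((\<lambda>s. mutual_info p0 (p s) (q s)) has_real_derivative
           - (1/2) * mutual_fisher (b t) p0 (p t) (q t)) (at t)"
proof -
  define a' where "a' = deriv (a t)"
  define \<sigma>' where "\<sigma>' = deriv (\<sigma> t)"
  define \<sigma>'' where "\<sigma>'' = deriv \<sigma>'"
  \<comment> \<open>Smoothness is assumed of \<sigma>, so the derivatives of b = \<sigma>^2 are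
    written out through those of \<sigma>.\<close>
  define b' where "b' x = 2 * \<sigma> t x * \<sigma>' x" for x
  define b'' where "b'' x = 2 * (\<sigma>' x * \<sigma>' x + \<sigma> t x * \<sigma>'' x)" for x
  \<comment> \<open>The common weight of the linear terms for all densities involved. Its continuity
    yields the measurability required for averaging.\<close>
  define g where "g x = a' x - b'' x / 2" for x
  have a: "(a t has_real_derivative a' x) (at x)" "isCont a' x" for x
    unfolding a'_def using smooth_on_derivatives[OF assms(3), of t] assms(17)
    by (auto intro: DERIV_isCont)
  have \<sigma>: "(\<sigma> t has_real_derivative \<sigma>' x) (at x)" "(\<sigma>' has_real_derivative \<sigma>'' x) (at x)"
    "isCont \<sigma>'' x" for x
    unfolding \<sigma>'_def \<sigma>''_def using smooth_on_derivatives[OF assms(4), of t] assms(17)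
    by auto
  have bt: "b t = (\<lambda>x. (\<sigma> t x)\<^sup>2)" using assms(6) by auto
  have b: "(b t has_real_derivative b' x) (at x)" "(b' has_real_derivative b'' x) (at x)" for x
    unfolding bt b'_def b''_def by (auto intro!: derivative_eq_intros \<sigma> simp: algebra_simps)
  have b'': "isCont b'' x" for x
    unfolding b''_def
    by (intro continuous_intros DERIV_isCont[OF \<sigma>(1)] DERIV_isCont[OF \<sigma>(2)] \<sigma>(3))
  have "isCont g x" for x
    unfolding g_def by (intro continuous_intros a b'') simp
  then have g: "g \<in> borel_measurable borel"
    by (intro borel_measurable_continuous_onI) (simp add: continuous_on_eq_continuous_at)

  note ent = dentropy_has_derivative[where a = a and b = b, OF _ _ assms(17) a b b'', folded g_def]
  have Dp: "((\<lambda>s. dentropy (p s)) has_real_derivative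
      (LINT x|lborel. g x * p t x) + 1/2 * fisher (b t) (p t)) (at t)"
    by (rule ent(1)[OF assms(12,14)])
  have Dq: "((\<lambda>s. dentropy (q s x0)) has_real_derivative
      (LINT x|lborel. g x * q t x0 x) + 1/2 * fisher (b t) (q t x0)) (at t)" for x0
    by (rule ent(1)[OF assms(13,15)])
  have p: "0 \<le> p t x" for x
    using assms(14,17) by (auto simp: regular_density_def intro: less_imp_le)
  note avg = cond_density_integral[OF assms(8,9) p assms(10)[OF assms(17)]
      assms(11)[OF assms(17)] g ent(2)[OF assms(12,14)]]

  \<comment> \<open>For fixed \<open>x0\<close> the weight \<open>p0 x0\<close> is constant in time,
    so the entropy formula for the conditional density gives the integrand of the differentiated
    average.\<close>
  have "deriv (\<lambda>s. p0 x0 * dentropy (q s x0)) t =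
      p0 x0 * (LINT x|lborel. g x * q t x0 x) + 1/2 * (p0 x0 * fisher (b t) (q t x0))" for x0
    by (rule DERIV_imp_deriv, rule DERIV_cong[OF DERIV_cmult[OF Dq]]) (simp add: algebra_simps)
  moreover have "diff_under_integral (\<lambda>s x0. p0 x0 * dentropy (q s x0)) t"
    and F: "integrable lborel (\<lambda>x0. p0 x0 * fisher (b t) (q t x0))"
    using assms(16,17) by (auto simp: regular_average_def)
  ultimately have "((\<lambda>s. cond_dentropy p0 (q s)) has_real_derivative
      (LINT x0|lborel. p0 x0 * (LINT x|lborel. g x * q t x0 x)
        + 1/2 * (p0 x0 * fisher (b t) (q t x0)))) (at t)"
    by (simp add: diff_under_integral_def cond_dentropy_def)
  \<comment> \<open>\<open>avg\<close> and \<open>F\<close> make both summands integrable, so the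
    average splits; \<open>avg\<close> then turns its linear part into the one found for
    \<open>p t\<close>, ready to cancel against \<open>Dp\<close>.\<close>
  moreover have "(LINT x0|lborel. p0 x0 * (LINT x|lborel. g x * q t x0 x)
        + 1/2 * (p0 x0 * fisher (b t) (q t x0))) =
      (LINT x|lborel. g x * p t x) + 1/2 * cond_fisher (b t) p0 (q t)"
    using avg F by (simp add: cond_fisher_def)
  ultimately have Dc: "((\<lambda>s. cond_dentropy p0 (q s)) has_real_derivative
      (LINT x|lborel. g x * p t x) + 1/2 * cond_fisher (b t) p0 (q t)) (at t)"
    by simp
  show ?thesis
    unfolding mutual_info_def mutual_fisher_def
    by (rule DERIV_cong[OF DERIV_diff[OF Dp Dc]]) (simp add: algebra_simps)
qed

end
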